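(* Let $f:\mathbb{R}^{n_1}\times\cdots\times\mathbb{R}^{n_m}\to\mathbb{R}$ be continuously differentiable and jointly convex with respect to all arguments, let $X^i\subseteq\mathbb{R}^{n_i}$, $i=1,\ldots,m$, be non-empty, compact and convex, let $X=X^1\times\cdots\times X^m$, and let $c>0$. Let $M=\arg\min_{z\in X}f(z)$ be the set of minimizers of $f$ over $X$, let $\widetilde{T}=(\widetilde{T}^1,\ldots,\widetilde{T}^m):X\to X$ be the regularized Jacobi mapping $$\widetilde{T}^i(x)=\arg\min_{z^i\in X^i}\left\{f(z^i,x^{-i})+c\|z^i-x^i\|^2\right\},\quad i=1,\ldots,m,$$ and let $F_{\widetilde{T}}=\{x\in X:\ x=\widetilde{T}(x)\}$. Then $M=F_{\widetilde{T}}$.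
   Context: Vectors are partitioned as $x=(x^1,\ldots,x^m)$ with $x^i\in\mathbb{R}^{n_i}$. The vector $x^{-i}$ collects all blocks of $x$ except the $i$-th, and $f(z^i,x^{-i})$ is the value of $f$ when the $i$-th block is $z^i$ and the other blocks are those of $x$. $\|\cdot\|$ is the Euclidean norm. The minimizer defining $\widetilde{T}^i(x)$ is unique because the objective is strictly convex in $z^i$. *)

theory Defs
  imports "HOL-Analysis.Analysis"
begin

text \<open>
  A product of \<open>m\<close> Euclidean spaces of dimensions \<open>n\<^sub>i\<close> is rendered as \<^typ>\<open>real ^ 'k\<close> with
  its coordinates partitioned by a map \<open>b :: 'k \<Rightarrow> 'm\<close>: coordinate \<open>k\<close> belongs to block \<open>b k\<close>,
  so \<open>m = CARD('m)\<close> and \<open>n\<^sub>i = card {k. b k = i}\<close>. Since the \<open>n\<^sub>i\<close> may differ, the \<open>i\<close>-th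
  factor is the coordinate subspace of all vectors that vanish outside block \<open>i\<close>, a linear
  isometric copy of the Euclidean space of dimension \<open>n\<^sub>i\<close>. In particular \<^term>\<open>norm\<close>,
  \<^term>\<open>compact\<close> and \<^term>\<open>convex\<close> have their usual meaning on it.
\<close>

definition block_space :: "('k::finite \<Rightarrow> 'm::finite) \<Rightarrow> 'm \<Rightarrow> (real ^ 'k) set" where
  "block_space b i = {v. \<forall>k. b k \<noteq> i \<longrightarrow> v $ k = 0}"

text \<open>\<open>x\<^sup>i\<close>, as an element of \<open>block_space b i\<close>\<close>

definition block :: "('k::finite \<Rightarrow> 'm::finite) \<Rightarrow> 'm \<Rightarrow> real ^ 'k \<Rightarrow> real ^ 'k" where
  "block b i x = (\<chi> k. if b k = i then x $ k else 0)"

text \<open>\<open>(z, x\<^sup>-\<^sup>i)\<close>\<close>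

definition replace_block ::
  "('k::finite \<Rightarrow> 'm::finite) \<Rightarrow> 'm \<Rightarrow> real ^ 'k \<Rightarrow> real ^ 'k \<Rightarrow> real ^ 'k" where
  "replace_block b i z x = (\<chi> k. if b k = i then z $ k else x $ k)"

definition block_product ::
  "('k::finite \<Rightarrow> 'm::finite) \<Rightarrow> ('m \<Rightarrow> (real ^ 'k) set) \<Rightarrow> (real ^ 'k) set" where
  "block_product b X = {x. \<forall>i. block b i x \<in> X i}"

definition continuously_differentiable :: "('a::euclidean_space \<Rightarrow> real) \<Rightarrow> bool" where
  "continuously_differentiable f \<longleftrightarrow>
     (\<exists>f' :: 'a \<Rightarrow> 'a \<Rightarrow>\<^sub>L real.
        (\<forall>x. (f has_derivative blinfun_apply (f' x)) (at x)) \<and> continuous_on UNIV f')"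

definition minimizers :: "('a \<Rightarrow> real) \<Rightarrow> 'a set \<Rightarrow> 'a set" where
  "minimizers f S = {z. is_arg_min f (\<lambda>z. z \<in> S) z}"

text \<open>
  \<^const>\<open>arg_min_on\<close> picks some minimizer. For \<open>f\<close> continuous and convex, \<open>c > 0\<close> and \<open>X i\<close>
  non-empty, compact and convex there is exactly one: the objective is strictly convex in \<open>z\<close>
  on \<open>block_space b i\<close>.
\<close>

definition reg_jacobi_block ::
  "('k::finite \<Rightarrow> 'm::finite) \<Rightarrow> (real ^ 'k \<Rightarrow> real) \<Rightarrow> ('m \<Rightarrow> (real ^ 'k) set) \<Rightarrow> real
    \<Rightarrow> 'm \<Rightarrow> real ^ 'k \<Rightarrow> real ^ 'k" where
  "reg_jacobi_block b f X c i x =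
     arg_min_on (\<lambda>z. f (replace_block b i z x) + c * (norm (z - block b i x))\<^sup>2) (X i)"

definition reg_jacobi ::
  "('k::finite \<Rightarrow> 'm::finite) \<Rightarrow> (real ^ 'k \<Rightarrow> real) \<Rightarrow> ('m \<Rightarrow> (real ^ 'k) set) \<Rightarrow> real
    \<Rightarrow> real ^ 'k \<Rightarrow> real ^ 'k" where
  "reg_jacobi b f X c x = (\<chi> k. reg_jacobi_block b f X c (b k) x $ k)"

definition fixed_points_on :: "'a set \<Rightarrow> ('a \<Rightarrow> 'a) \<Rightarrow> 'a set" where
  "fixed_points_on S T = {x \<in> S. x = T x}"

end

theory Submission
  imports Defs
begin

text \<open>
  The regularizer is positive except at \<open>x\<^sup>i\<close>, and it vanishes there to second order. Positivity
  gives one inclusion, the second-order vanishing gives the other.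

  If \<open>x\<close> minimizes \<open>f\<close> over the product, then changing a single block to \<open>z \<noteq> x\<^sup>i\<close> stays in the
  product, so it cannot decrease \<open>f\<close>, while it strictly increases the regularizer. Hence \<open>x\<^sup>i\<close> is
  the only minimizer of the \<open>i\<close>-th regularized problem, and \<open>x\<close> is a fixed point.

  Conversely, let \<open>x\<close> be a fixed point and \<open>D\<close> the derivative of \<open>f\<close> at \<open>x\<close>. Moving a small step
  \<open>t\<close> from \<open>x\<^sup>i\<close> towards \<open>z \<in> X\<^sup>i\<close> changes \<open>f\<close> by \<open>t D(z - x\<^sup>i) + o(t)\<close> and the regularizer by
  \<open>O(t\<^sup>2)\<close>, so optimality of \<open>x\<^sup>i\<close> forces \<open>D(z - x\<^sup>i) \<ge> 0\<close>
  (lemma \<open>derivative_nonneg_if_quadratic_lower_bound\<close>). A displacement \<open>y - x\<close> within the product is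
  the sum of its blocks, so linearity of \<open>D\<close> turns these blockwise conditions into
  \<open>D(y - x) \<ge> 0\<close> for all \<open>y\<close> in the product. Convexity of \<open>f\<close> then gives
  \<open>f y \<ge> f x + D(y - x) \<ge> f x\<close> (lemma \<open>convex_on_above_tangent\<close>). Differentiability is essential in
  this last summation step: for nonsmooth \<open>f\<close>, blockwise optimality does not imply joint optimality.
\<close>

section \<open>Directional derivatives\<close>

lemma has_derivative_directional_limit:
  fixes f :: "'a::real_normed_vector \<Rightarrow> real"
  assumes "(f has_derivative D) (at x)"
  shows "((\<lambda>t. (f (x + t *\<^sub>R v) - f x) / t) \<longlongrightarrow> D v) (at_right 0)"
proof -
  interpret D: bounded_linear D
    using assms by (rule has_derivative_bounded_linear)
  have "((\<lambda>t. f (x + t *\<^sub>R v)) has_derivative (\<lambda>h. D (h *\<^sub>R v))) (at 0)"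
    by (rule has_derivative_compose[where g = f]) (use assms in \<open>auto intro!: derivative_eq_intros\<close>)
  moreover have "(\<lambda>h. D (h *\<^sub>R v)) = (*) (D v)"
    by (simp add: fun_eq_iff D.scaleR)
  ultimately have "((\<lambda>t. f (x + t *\<^sub>R v)) has_field_derivative D v) (at 0)"
    by (simp add: has_field_derivative_def)
  then have "((\<lambda>t. (f (x + t *\<^sub>R v) - f x) / t) \<longlongrightarrow> D v) (at 0)"
    by (simp add: DERIV_def)
  then show ?thesis
    by (rule filterlim_mono) (simp_all add: at_le)
qed

text \<open>
  Convexity makes the difference quotient from \<open>x\<close> towards \<open>y\<close> at most \<open>f y - f x\<close>
  for every step in \<open>(0, 1)\<close>, and this bound survives in the limit.
\<close>

lemma convex_on_above_tangent:
  fixes f :: "'a::real_normed_vector \<Rightarrow> real"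
  assumes "convex_on S f" "x \<in> S" "y \<in> S" "(f has_derivative D) (at x)"
  shows "f x + D (y - x) \<le> f y"
proof -
  have "(f (x + t *\<^sub>R (y - x)) - f x) / t \<le> f y - f x" if "0 < t" "t < 1" for t :: real
  proof -
    have "f ((1 - t) *\<^sub>R x + t *\<^sub>R y) \<le> (1 - t) * f x + t * f y"
      using assms that by (intro convex_onD) auto
    moreover have "(1 - t) *\<^sub>R x + t *\<^sub>R y = x + t *\<^sub>R (y - x)"
      by (simp add: algebra_simps)
    ultimately have "f (x + t *\<^sub>R (y - x)) - f x \<le> (f y - f x) * t"
      by (simp add: left_diff_distrib right_diff_distrib mult.commute)
    then show ?thesis
      using that by (simp add: pos_divide_le_eq)
  qed
  then have "\<forall>\<^sub>F t in at_right 0. (f (x + t *\<^sub>R (y - x)) - f x) / t \<le> f y - f x"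
    by (auto simp: eventually_at_right_field intro: exI[of _ 1])
  then have "D (y - x) \<le> f y - f x"
    by (intro tendsto_upperbound[OF has_derivative_directional_limit[OF assms(4)]]) auto
  then show ?thesis by simp
qed

text \<open>
  Dividing by the step \<open>t\<close> leaves a lower bound \<open>-K t\<close> on the difference quotient, which
  vanishes as \<open>t\<close> tends to \<open>0\<close>: a quadratic penalty is invisible to first order.
\<close>

lemma derivative_nonneg_if_quadratic_lower_bound:
  fixes f :: "'a::real_normed_vector \<Rightarrow> real"
  assumes "(f has_derivative D) (at x)"
    and lower: "\<And>t. 0 < t \<Longrightarrow> t < 1 \<Longrightarrow> f x \<le> f (x + t *\<^sub>R v) + K * t\<^sup>2"
  shows "0 \<le> D v"
proof -
  have "0 \<le> (f (x + t *\<^sub>R v) - f x) / t + K * t" if "0 < t" "t < 1" for t :: real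
  proof -
    have "(f (x + t *\<^sub>R v) - f x) / t + K * t = (f (x + t *\<^sub>R v) + K * t\<^sup>2 - f x) / t"
      using that by (simp add: field_simps power2_eq_square)
    then show ?thesis using lower[OF that] that by simp
  qed
  then have "\<forall>\<^sub>F t in at_right 0. 0 \<le> (f (x + t *\<^sub>R v) - f x) / t + K * t"
    by (auto simp: eventually_at_right_field intro: exI[of _ 1])
  moreover have "((\<lambda>t. (f (x + t *\<^sub>R v) - f x) / t + K * t) \<longlongrightarrow> D v + K * 0) (at_right 0)"
    by (intro tendsto_intros has_derivative_directional_limit assms)
  ultimately have "0 \<le> D v + K * 0"
    by (intro tendsto_lowerbound[where F = "at_right (0::real)"]) auto
  then show ?thesis by simp
qed

section \<open>Blocks\<close>

lemma replace_block_eq_add: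
  assumes "z \<in> block_space b i"
  shows "replace_block b i z x = x + (z - block b i x)"
  using assms by (auto simp: vec_eq_iff replace_block_def block_def block_space_def)

lemma block_replace_block:
  assumes "z \<in> block_space b i"
  shows "block b j (replace_block b i z x) = (if j = i then z else block b j x)"
  using assms by (auto simp: vec_eq_iff replace_block_def block_def block_space_def)

lemma replace_block_in_block_product:
  assumes "X i \<subseteq> block_space b i" "x \<in> block_product b X" "z \<in> X i"
  shows "replace_block b i z x \<in> block_product b X"
  using assms by (auto simp: block_product_def block_replace_block subset_iff)

lemma sum_block: "(\<Sum>i\<in>UNIV. block b i x) = x"
  by (simp add: vec_eq_iff block_def sum.delta)

text \<open>
  The mapping \<^const>\<open>reg_jacobi\<close> keeps only the coordinates of the \<open>i\<close>-th minimizer that belong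
  to block \<open>i\<close>; nothing is lost when all the others are zero.
\<close>

lemma block_reg_jacobi:
  assumes "reg_jacobi_block b f X c i x \<in> block_space b i"
  shows "block b i (reg_jacobi b f X c x) = reg_jacobi_block b f X c i x"
  using assms by (auto simp: vec_eq_iff block_def reg_jacobi_def block_space_def)

section \<open>Minimizers as values of the regularized Jacobi mapping\<close>

lemma arg_min_on_eq_strict_minimizer:
  fixes g :: "'a \<Rightarrow> 'b::order"
  assumes "x \<in> S" and "\<And>y. y \<in> S \<Longrightarrow> y \<noteq> x \<Longrightarrow> g x < g y"
  shows "arg_min_on g S = x"
  unfolding arg_min_on_def arg_min_def
proof (rule some_equality)
  show "is_arg_min g (\<lambda>x. x \<in> S) x"
    using assms by (metis is_arg_min_def less_asym)
next
  fix y assume "is_arg_min g (\<lambda>x. x \<in> S) y"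
  then show "y = x"
    using assms by (auto simp: is_arg_min_def)
qed

lemma is_arg_min_arg_min_on_compact:
  fixes g :: "'a::topological_space \<Rightarrow> real"
  assumes "compact S" "S \<noteq> {}" "continuous_on S g"
  shows "is_arg_min g (\<lambda>x. x \<in> S) (arg_min_on g S)"
proof -
  obtain x where "x \<in> S" "\<forall>y\<in>S. g x \<le> g y"
    using continuous_attains_inf[OF assms] by blast
  then have "is_arg_min g (\<lambda>x. x \<in> S) x"
    by (auto simp: is_arg_min_linorder)
  then show ?thesis
    unfolding arg_min_on_def arg_min_def by (rule someI)
qed

text \<open>
  The minimality is stated for displacements of \<open>x\<close>, the form in which the derivative of \<open>f\<close>
  at \<open>x\<close> applies.
\<close>

lemma reg_jacobi_block_minimizes:
  assumes "continuous_on UNIV f" "X i \<subseteq> block_space b i" "compact (X i)" "X i \<noteq> {}"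
  shows "reg_jacobi_block b f X c i x \<in> X i"
    and "z \<in> X i \<Longrightarrow>
      f (x + (reg_jacobi_block b f X c i x - block b i x))
        + c * (norm (reg_jacobi_block b f X c i x - block b i x))\<^sup>2
      \<le> f (x + (z - block b i x)) + c * (norm (z - block b i x))\<^sup>2"
proof -
  let ?g = "\<lambda>z. f (replace_block b i z x) + c * (norm (z - block b i x))\<^sup>2"
  let ?h = "\<lambda>z. f (x + (z - block b i x)) + c * (norm (z - block b i x))\<^sup>2"
  have gh: "?g z = ?h z" if "z \<in> X i" for z
    using that assms(2) by (simp add: replace_block_eq_add subset_iff)
  have "continuous_on (X i) ?h"
    by (intro continuous_intros continuous_on_compose2[OF assms(1)]) auto
  then have "continuous_on (X i) ?g"
    using gh by (subst continuous_on_cong[OF refl]) auto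
  then have min: "is_arg_min ?g (\<lambda>z. z \<in> X i) (reg_jacobi_block b f X c i x)"
    unfolding reg_jacobi_block_def using assms(3,4) by (intro is_arg_min_arg_min_on_compact)
  then show mem: "reg_jacobi_block b f X c i x \<in> X i"
    by (simp add: is_arg_min_linorder)
  show "?h (reg_jacobi_block b f X c i x) \<le> ?h z" if "z \<in> X i"
    using min gh[OF that] gh[OF mem] that by (auto simp: is_arg_min_linorder)
qed

text \<open>
  Changing one block of a minimizer stays in the product, so it cannot decrease \<open>f\<close>, and the
  regularizer makes the change strictly unfavourable. Strictness is what determines the value
  of \<^const>\<open>arg_min_on\<close>.
\<close>

lemma minimizers_subset_fixed_points:
  assumes "\<And>i. X i \<subseteq> block_space b i" "c > 0"
  shows "minimizers f (block_product b X) \<subseteq> fixed_points_on (block_product b X) (reg_jacobi b f X c)"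
proof
  fix x assume "x \<in> minimizers f (block_product b X)"
  then have mem: "x \<in> block_product b X" and min: "\<And>y. y \<in> block_product b X \<Longrightarrow> f x \<le> f y"
    by (auto simp: minimizers_def is_arg_min_linorder)
  have "reg_jacobi_block b f X c i x = block b i x" for i
    unfolding reg_jacobi_block_def
  proof (rule arg_min_on_eq_strict_minimizer)
    show mem_i: "block b i x \<in> X i"
      using mem by (simp add: block_product_def)
    fix z assume z: "z \<in> X i" "z \<noteq> block b i x"
    have "replace_block b i (block b i x) x = x"
      using mem_i assms(1)[of i] by (simp add: replace_block_eq_add subset_iff)
    moreover have "f x \<le> f (replace_block b i z x)"
      using replace_block_in_block_product[OF assms(1) mem z(1)] by (rule min)
    moreover have "0 < c * (norm (z - block b i x))\<^sup>2"
      using z \<open>c > 0\<close> by simp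
    ultimately show "f (replace_block b i (block b i x) x) + c * (norm (block b i x - block b i x))\<^sup>2
        < f (replace_block b i z x) + c * (norm (z - block b i x))\<^sup>2"
      by simp
  qed
  then have "reg_jacobi b f X c x = x"
    by (simp add: vec_eq_iff reg_jacobi_def block_def)
  then show "x \<in> fixed_points_on (block_product b X) (reg_jacobi b f X c)"
    using mem by (simp add: fixed_points_on_def)
qed

text \<open>
  The comparison points lie on the segment from \<open>x\<^sup>i\<close> to \<open>z\<close>, which stays in \<open>X i\<close> by convexity.
  At parameter \<open>t\<close> on it the regularizer is \<open>c (norm (z - x\<^sup>i))\<^sup>2 t\<^sup>2\<close>, a quadratic in \<open>t\<close>.
\<close>

lemma fixed_point_blockwise_stationary:
  assumes "continuous_on UNIV f" "(f has_derivative D) (at x)"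
    and "X i \<subseteq> block_space b i" "compact (X i)" "convex (X i)"
    and "reg_jacobi b f X c x = x" "z \<in> X i"
  shows "0 \<le> D (z - block b i x)"
proof (rule derivative_nonneg_if_quadratic_lower_bound[OF assms(2)])
  let ?v = "z - block b i x"
  have "X i \<noteq> {}"
    using assms(7) by blast
  note minimizes = reg_jacobi_block_minimizes
      [where X = X and i = i and c = c and x = x, OF assms(1,3,4) this]
  have fixed: "reg_jacobi_block b f X c i x = block b i x"
    using block_reg_jacobi[of b f X c i x] minimizes(1) assms(3,6,7) by auto
  fix t :: real assume t: "0 < t" "t < 1"
  have mem: "block b i x + t *\<^sub>R ?v \<in> X i"
  proof -
    have "(1 - t) *\<^sub>R block b i x + t *\<^sub>R z \<in> X i"
      using assms(5,7) minimizes(1) fixed t by (intro convexD) auto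
    then show ?thesis by (simp add: algebra_simps)
  qed
  show "f x \<le> f (x + t *\<^sub>R ?v) + c * (norm ?v)\<^sup>2 * t\<^sup>2"
    using minimizes(2)[OF mem] assms(7) unfolding fixed
    by (auto simp: power_mult_distrib mult_ac)
qed

theorem corollary1:
  fixes b :: "'k::finite \<Rightarrow> 'm::finite"
    and f :: "real ^ 'k \<Rightarrow> real"
    and X :: "'m \<Rightarrow> (real ^ 'k) set"
    and c :: real
  assumes "continuously_differentiable f"
    and "convex_on UNIV f"
    and "\<And>i. X i \<subseteq> block_space b i"
    and "\<And>i. X i \<noteq> {}"
    and "\<And>i. compact (X i)"
    and "\<And>i. convex (X i)"
    and "c > 0"
  shows "minimizers f (block_product b X) =
         fixed_points_on (block_product b X) (reg_jacobi b f X c)"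
proof
  show "minimizers f (block_product b X) \<subseteq>
      fixed_points_on (block_product b X) (reg_jacobi b f X c)"
    using assms(3,7) by (rule minimizers_subset_fixed_points)
next
  obtain f' where f': "\<And>x. (f has_derivative blinfun_apply (f' x)) (at x)"
    using assms(1) by (auto simp: continuously_differentiable_def)
  have cont: "continuous_on UNIV f"
    using has_derivative_continuous[OF f'] by (simp add: continuous_at_imp_continuous_on)
  show "fixed_points_on (block_product b X) (reg_jacobi b f X c) \<subseteq>
      minimizers f (block_product b X)"
  proof
    fix x assume "x \<in> fixed_points_on (block_product b X) (reg_jacobi b f X c)"
    then have mem: "x \<in> block_product b X" and fixed: "reg_jacobi b f X c x = x"
      by (auto simp: fixed_points_on_def)
    have "f x \<le> f y" if y: "y \<in> block_product b X" for y
    proof -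
      have "0 \<le> f' x (block b i y - block b i x)" for i
        using fixed_point_blockwise_stationary[OF cont f' assms(3,5,6) fixed] y
        by (simp add: block_product_def)
      then have "0 \<le> (\<Sum>i\<in>UNIV. f' x (block b i y - block b i x))"
        by (intro sum_nonneg) auto
      also have "\<dots> = f' x (\<Sum>i\<in>UNIV. block b i y - block b i x)"
        by (simp add: blinfun.sum_right)
      also have "\<dots> = f' x (y - x)"
        by (simp add: sum_subtractf sum_block)
      finally show ?thesis
        using convex_on_above_tangent[OF assms(2) _ _ f'[of x], of y] by simp
    qed
    then show "x \<in> minimizers f (block_product b X)"
      using mem by (simp add: minimizers_def is_arg_min_linorder)
  qed
qed

end
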